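(* For every integer $n \geq 10$, it holds that $\mathrm{WL}_1(n) \in \{n-2, n-1\}$.
   Context: All graphs are finite, simple and undirected. Colour Refinement on a graph $G$ (with monochromatic initial colouring) computes colourings $\chi^i_G$: $\chi^0_G$ is constant, and for $i \geq 1$, $\chi^i_G(v) = \big(\chi^{i-1}_G(v), \{\!\{\chi^{i-1}_G(w) \mid w \in N(v)\}\!\}\big)$, where $N(v)$ is the neighbourhood of $v$ and $\{\!\{\cdot\}\!\}$ denotes a multiset. Let $\pi^i_G$ be the partition of $V(G)$ into colour classes of $\chi^i_G$. $\mathrm{WL}_1(G)$ is the least $j \geq 0$ such that $\pi^j_G = \pi^{j+1}_G$, and for $n \in \mathbb{N}$, $\mathrm{WL}_1(n)$ is the maximum of $\mathrm{WL}_1(G)$ over all graphs $G$ with $n$ vertices. *)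

theory Defs
  imports "Graph_Theory.Graph_Theory" "HOL-Library.Multiset"
begin

text \<open>
  Finite simple undirected graphs are the \<open>pair_graph\<close>s of \<open>Graph_Theory\<close>: finite, loop-free
  arc relations that are symmetric, so that an undirected edge is a pair of opposite arcs.
\<close>

definition neighbourhood :: "'a pair_pre_digraph \<Rightarrow> 'a \<Rightarrow> 'a set" where
  "neighbourhood G v = {w. (v, w) \<in> parcs G}"

text \<open>
  The colours of round \<open>i + 1\<close> are pairs of a colour and a multiset of colours of round \<open>i\<close>.
  The free type below holds the colours of all rounds at once; \<open>Refined c M\<close> is the pair
  \<open>(c, M)\<close>.
\<close>

datatype colour = Initial | Refined colour "colour multiset"

primrec colour_refinement :: "'a pair_pre_digraph \<Rightarrow> nat \<Rightarrow> 'a \<Rightarrow> colour" where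
  "colour_refinement G 0 v = Initial"
| "colour_refinement G (Suc i) v =
     Refined (colour_refinement G i v)
       (image_mset (colour_refinement G i) (mset_set (neighbourhood G v)))"

definition colour_classes :: "'a pair_pre_digraph \<Rightarrow> nat \<Rightarrow> 'a set set" where
  "colour_classes G i =
     (\<lambda>v. {w \<in> pverts G. colour_refinement G i w = colour_refinement G i v}) ` pverts G"

definition WL1 :: "'a pair_pre_digraph \<Rightarrow> nat" where
  "WL1 G = (LEAST j. colour_classes G j = colour_classes G (Suc j))"

text \<open>
  Every finite graph is isomorphic to one with vertices in \<open>nat\<close>, so the maximum may be taken
  over graphs on finite sets of natural numbers.
\<close>

definition WL1_max :: "nat \<Rightarrow> nat" where
  "WL1_max n = Max {WL1 G | G :: nat pair_pre_digraph. pair_graph G \<and> card (pverts G) = n}"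


text \<open>The minimum in \<open>WL1\<close> and the maximum in \<open>WL1_max\<close> are attained.\<close>

lemma card_colour_classes:
  "card (colour_classes G i) = card (colour_refinement G i ` pverts G)"
proof -
  let ?f = "\<lambda>c. {w \<in> pverts G. colour_refinement G i w = c}"
  have "colour_classes G i = ?f ` colour_refinement G i ` pverts G"
    by (auto simp: colour_classes_def)
  moreover have "inj_on ?f (colour_refinement G i ` pverts G)"
    by (auto simp: inj_on_def)
  ultimately show ?thesis
    by (simp add: card_image)
qed

lemma card_colour_classes_less:
  assumes "finite (pverts G)" and neq: "colour_classes G i \<noteq> colour_classes G (Suc i)"
  shows "card (colour_classes G i) < card (colour_classes G (Suc i))"
proof (rule ccontr)
  let ?p = "\<lambda>c. case c of Refined d M \<Rightarrow> d"
  let ?A = "colour_refinement G (Suc i) ` pverts G"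
  have im: "colour_refinement G i ` pverts G = ?p ` ?A"
    by (simp add: image_image)
  assume "\<not> ?thesis"
  then have "card (?p ` ?A) = card ?A"
    using card_image_le[of ?A ?p] assms(1) im by (simp add: card_colour_classes)
  then have inj: "inj_on ?p ?A"
    using assms(1) by (intro eq_card_imp_inj_on) auto
  have "colour_refinement G i w = colour_refinement G i v \<longleftrightarrow>
      colour_refinement G (Suc i) w = colour_refinement G (Suc i) v"
    if "v \<in> pverts G" "w \<in> pverts G" for v w
    using inj_on_eq_iff[OF inj, of "colour_refinement G (Suc i) w" "colour_refinement G (Suc i) v"]
      that by simp
  then have "colour_classes G i = colour_classes G (Suc i)"
    unfolding colour_classes_def by (intro image_cong) auto
  with neq show False ..
qed

lemma colour_classes_stable_exists:
  assumes "finite (pverts G)"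
  shows "\<exists>j \<le> card (pverts G). colour_classes G j = colour_classes G (Suc j)"
proof (rule ccontr)
  assume unstable: "\<not> ?thesis"
  have "j \<le> card (colour_classes G j)" if "j \<le> Suc (card (pverts G))" for j
    using that
  proof (induction j)
    case (Suc j)
    then show ?case
      using card_colour_classes_less[OF assms, of j] unstable by fastforce
  qed simp
  from this[of "Suc (card (pverts G))"] show False
    using card_image_le[OF assms, of "colour_refinement G (Suc (card (pverts G)))"]
    by (simp add: card_colour_classes)
qed

lemma WL1_stable:
  assumes "finite (pverts G)"
  shows "colour_classes G (WL1 G) = colour_classes G (Suc (WL1 G))"
  using colour_classes_stable_exists[OF assms] unfolding WL1_def by (metis (lifting) LeastI)

lemma WL1_le_card:
  assumes "finite (pverts G)"
  shows "WL1 G \<le> card (pverts G)"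
  using colour_classes_stable_exists[OF assms] unfolding WL1_def
  by (meson Least_le order_trans)

lemma finite_WL1_values:
  "finite {WL1 G | G :: nat pair_pre_digraph. pair_graph G \<and> card (pverts G) = n}"
proof (rule finite_subset)
  show "{WL1 G | G :: nat pair_pre_digraph. pair_graph G \<and> card (pverts G) = n} \<subseteq> {..n}"
    by (auto simp: pair_graph_def pair_digraph_def pair_fin_digraph_def
        pair_fin_digraph_axioms_def intro: WL1_le_card)
qed simp

lemma WL1_values_nonempty:
  "{WL1 G | G :: nat pair_pre_digraph. pair_graph G \<and> card (pverts G) = n} \<noteq> {}"
proof -
  have "pair_graph \<lparr> pverts = {..<n}, parcs = {} \<rparr>"
    by unfold_locales (auto simp: symmetric_def with_proj_def arcs_ends_def sym_def)
  then show ?thesis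
    by (auto intro!: exI[of _ "\<lparr> pverts = {..<n}, parcs = {} \<rparr>"])
qed

end

theory Submission
  imports Defs
begin

text \<open>
  While the partition is not stable, every round adds at least one colour class, whence the upper
  bound \<open>n - 1\<close>. The lower bound needs a graph on \<open>n\<close> vertices in which two vertices get different
  colours eventually, but not before round \<open>n - 2\<close>.

  For even \<open>n \<ge> 14\<close> take a path of \<open>n / 2\<close> pairs, consecutive pairs being joined by a matching, and
  join the two vertices of the first pair to all of the pair before and all of the pair after a
  central pair, respectively. Edges inside almost all other pairs leave three pairs of degree 2,
  which lie at the ends of three arms of equal length (up to 1). The refinement is a wave that runs
  up the three arms simultaneously, then runs along the path from the first pair to the centre and
  thereby separates the arms, and only then, because the two central neighbour pairs of the first
  pair have been told apart, splits the pairs themselves, one per round along the whole path. For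
  odd \<open>n\<close> a hub joined to the vertices of degree 2 delays all this by one round.
\<close>

subsection \<open>Colour refinement on graphs given by adjacency lists\<close>

definition list_graph :: "'a set \<Rightarrow> ('a \<Rightarrow> 'a list) \<Rightarrow> 'a pair_pre_digraph" where
  "list_graph V nb = \<lparr> pverts = V, parcs = {(v, w). v \<in> V \<and> w \<in> set (nb v)} \<rparr>"

lemma pverts_list_graph [simp]: "pverts (list_graph V nb) = V"
  by (simp add: list_graph_def)

text \<open>On \<open>V\<close> the function \<open>g\<close> factors through \<open>f\<close>, so
  the image under \<open>g\<close> can be computed from the image under \<open>f\<close>.\<close>

lemma image_mset_eq_coarser:
  assumes "image_mset f M = image_mset f N" "set_mset M \<subseteq> V" "set_mset N \<subseteq> V"
    and "\<And>u v. u \<in> V \<Longrightarrow> v \<in> V \<Longrightarrow> f u = f v \<Longrightarrow> g u = g v"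
  shows "image_mset g M = image_mset g N"
proof -
  define h where "h x = g (SOME u. u \<in> V \<and> f u = x)" for x
  have h: "h (f u) = g u" if "u \<in> V" for u
    unfolding h_def using that assms(4) by (metis (mono_tags, lifting) someI_ex)
  have "image_mset g M = image_mset h (image_mset f M)"
    using assms(2) h by (auto simp: multiset.map_comp intro!: image_mset_cong)
  also have "\<dots> = image_mset g N"
    unfolding assms(1) using assms(3) h by (auto simp: multiset.map_comp intro!: image_mset_cong)
  finally show ?thesis .
qed

section \<open>Persistence of colour differences and stability\<close>

lemma colour_refinement_eq_mono:
  assumes "i \<le> j" "colour_refinement G j u = colour_refinement G j v"
  shows "colour_refinement G i u = colour_refinement G i v"
  using assms by (induction j rule: dec_induct) auto

text \<open>The old colour inside a refined colour is redundant: the neighbours' colours in one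
  round determine those in the round before, and hence, by induction, the old colour. Later
  arguments therefore compare neighbourhoods only.\<close>

lemma colour_refinement_Suc_eq_iff:
  "colour_refinement G (Suc i) u = colour_refinement G (Suc i) v \<longleftrightarrow>
     image_mset (colour_refinement G i) (mset_set (neighbourhood G u)) =
     image_mset (colour_refinement G i) (mset_set (neighbourhood G v))"
proof (induction i)
  case 0
  have "colour_refinement G 0 = (\<lambda>_. Initial)"
    by auto
  then show ?case
    by simp
next
  case (Suc i)
  have "image_mset (colour_refinement G i) (mset_set (neighbourhood G u)) =
      image_mset (colour_refinement G i) (mset_set (neighbourhood G v))"
    if "image_mset (colour_refinement G (Suc i)) (mset_set (neighbourhood G u)) =
      image_mset (colour_refinement G (Suc i)) (mset_set (neighbourhood G v))"
    using that by (rule image_mset_eq_coarser[where V = UNIV]) (auto dest: colour_refinement_eq_mono)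
  then show ?case
    unfolding colour_refinement.simps(2)[of G "Suc i"] colour.inject Suc.IH by blast
qed

lemma colour_classes_stableD:
  assumes "colour_classes G i = colour_classes G j" "u \<in> pverts G" "v \<in> pverts G"
    and "colour_refinement G i u = colour_refinement G i v"
  shows "colour_refinement G j u = colour_refinement G j v"
proof -
  have "{w \<in> pverts G. colour_refinement G i w = colour_refinement G i v} \<in> colour_classes G j"
    using assms(1,3) unfolding colour_classes_def by blast
  then obtain x where "{w \<in> pverts G. colour_refinement G i w = colour_refinement G i v} =
      {w \<in> pverts G. colour_refinement G j w = colour_refinement G j x}"
    unfolding colour_classes_def by blast
  then show ?thesis
    using assms by (metis (mono_tags, lifting) mem_Collect_eq)
qed

text \<open>A stable partition stays stable, so vertices that agree in round \<open>WL1 G\<close>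
  agree forever. Two vertices that agree in round \<open>r\<close> and differ in any round
  \<open>j\<close> thus show that stability comes after \<open>r\<close>.\<close>

lemma less_WL1I:
  assumes "finite (pverts G)" and nbh: "\<And>v. neighbourhood G v \<subseteq> pverts G"
    and uv: "u \<in> pverts G" "v \<in> pverts G"
    and eq: "colour_refinement G r u = colour_refinement G r v"
    and neq: "colour_refinement G j u \<noteq> colour_refinement G j v"
  shows "r < WL1 G"
proof (rule ccontr)
  define W where "W = WL1 G"
  assume "\<not> r < WL1 G"
  then have W: "colour_refinement G W u = colour_refinement G W v"
    using colour_refinement_eq_mono[OF _ eq] by (simp add: W_def)
  have nbh': "set_mset (mset_set (neighbourhood G v)) \<subseteq> pverts G" for v
    using nbh[of v] assms(1) by (metis finite_set_mset_mset_set finite_subset)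
  have "colour_refinement G (W + k) x = colour_refinement G (W + k) y"
    if "x \<in> pverts G" "y \<in> pverts G" "colour_refinement G W x = colour_refinement G W y" for k x y
    using that
  proof (induction k arbitrary: x y)
    case (Suc k)
    have "colour_refinement G (Suc W) x = colour_refinement G (Suc W) y"
      by (rule colour_classes_stableD[OF _ Suc.prems]) (simp only: W_def WL1_stable[OF assms(1)])
    then have "image_mset (colour_refinement G (W + k)) (mset_set (neighbourhood G x)) =
        image_mset (colour_refinement G (W + k)) (mset_set (neighbourhood G y))"
      unfolding colour_refinement_Suc_eq_iff
      by (rule image_mset_eq_coarser[OF _ nbh' nbh' Suc.IH])
    then show ?case
      using colour_refinement_Suc_eq_iff[of G "W + k" x y] by simp
  qed simp
  then have "colour_refinement G (W + j) u = colour_refinement G (W + j) v"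
    using uv W by blast
  then have "colour_refinement G j u = colour_refinement G j v"
    by (rule colour_refinement_eq_mono[OF le_add2])
  with neq show False ..
qed

text \<open>Round 0 has one class, since there are vertices, and every round before stability adds
  at least one more.\<close>

lemma WL1_less_card:
  assumes "finite (pverts G)" "pverts G \<noteq> {}"
  shows "WL1 G < card (pverts G)"
proof -
  have "i < card (colour_classes G i)" if "i \<le> WL1 G" for i
    using that
  proof (induction i)
    case 0
    then show ?case
      using assms by (simp add: card_colour_classes card_gt_0_iff)
  next
    case (Suc i)
    then have "colour_classes G i \<noteq> colour_classes G (Suc i)"
      unfolding WL1_def by (metis (mono_tags, lifting) Suc_le_lessD not_less_Least)
    then show ?case
      using Suc card_colour_classes_less[OF assms(1), of i] by simp
  qed
  then have "WL1 G < card (colour_classes G (WL1 G))"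
    by simp
  also have "\<dots> \<le> card (pverts G)"
    using card_image_le[OF assms(1)] by (simp add: card_colour_classes)
  finally show ?thesis .
qed

section \<open>Adjacency lists and transfer to graphs on natural numbers\<close>

locale adjacency_lists =
  fixes V :: "'a set" and nb :: "'a \<Rightarrow> 'a list"
  assumes finite_V: "finite V"
    and nb_subset: "v \<in> V \<Longrightarrow> set (nb v) \<subseteq> V"
    and nb_distinct: "v \<in> V \<Longrightarrow> distinct (nb v)"
    and nb_sym: "v \<in> V \<Longrightarrow> w \<in> set (nb v) \<Longrightarrow> v \<in> set (nb w)"
    and nb_irrefl: "v \<in> V \<Longrightarrow> v \<notin> set (nb v)"
begin

abbreviation "col \<equiv> colour_refinement (list_graph V nb)"

lemma neighbourhood_list_graph:
  "v \<in> V \<Longrightarrow> mset_set (neighbourhood (list_graph V nb) v) = mset (nb v)"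
  using nb_distinct by (auto simp: neighbourhood_def list_graph_def mset_set_set)

lemma pair_graph_list_graph: "pair_graph (list_graph V nb)"
proof
  show "finite (pverts (list_graph V nb))"
    using finite_V by simp
  have "parcs (list_graph V nb) \<subseteq> V \<times> V"
    using nb_subset by (auto simp: list_graph_def)
  then show "finite (parcs (list_graph V nb))"
    using finite_V finite_subset by blast
  show "symmetric (with_proj (list_graph V nb))"
    unfolding symmetric_def sym_def using nb_sym nb_subset
    by (auto simp: list_graph_def with_proj_def arcs_ends_def arc_to_ends_def)
qed (use nb_irrefl in \<open>auto simp: list_graph_def dest: nb_subset[THEN subsetD]\<close>)

lemma col_Suc_eq_iff:
  assumes "u \<in> V" "v \<in> V"
  shows "col (Suc i) u = col (Suc i) v \<longleftrightarrow>
    image_mset (col i) (mset (nb u)) = image_mset (col i) (mset (nb v))"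
  using assms by (simp only: colour_refinement_Suc_eq_iff neighbourhood_list_graph)

lemma less_WL1_list_graphI:
  assumes "u \<in> V" "v \<in> V" "col r u = col r v" "col j u \<noteq> col j v"
  shows "r < WL1 (list_graph V nb)"
proof (rule less_WL1I)
  show "neighbourhood (list_graph V nb) v \<subseteq> pverts (list_graph V nb)" for v
    using nb_subset by (auto simp: neighbourhood_def list_graph_def)
qed (use assms finite_V in auto)

text \<open>Colour refinement is the coarsest sequence of colourings in which each round determines
  the neighbours' colours of the round before. Any \<open>c\<close> with this property up to round
  \<open>r\<close> therefore bounds the speed of refinement from above.\<close>

lemma col_eq_of_coarser:
  assumes refine: "\<And>i u v. i < r \<Longrightarrow> u \<in> V \<Longrightarrow> v \<in> V \<Longrightarrow> c (Suc i) u = c (Suc i) v \<Longrightarrow>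
      image_mset (c i) (mset (nb u)) = image_mset (c i) (mset (nb v))"
    and "i \<le> r" "u \<in> V" "v \<in> V" "c i u = c i v"
  shows "col i u = col i v"
  using assms(2-)
proof (induction i arbitrary: u v)
  case (Suc i)
  have "image_mset (c i) (mset (nb u)) = image_mset (c i) (mset (nb v))"
    using Suc.prems by (intro refine) simp_all
  then have "image_mset (col i) (mset (nb u)) = image_mset (col i) (mset (nb v))"
  proof (rule image_mset_eq_coarser[where V = V])
    show "set_mset (mset (nb u)) \<subseteq> V" "set_mset (mset (nb v)) \<subseteq> V"
      using nb_subset Suc.prems by simp_all
    show "col i x = col i y" if "x \<in> V" "y \<in> V" "c i x = c i y" for x y
      using that Suc.prems(1) by (intro Suc.IH) simp_all
  qed
  then show ?case
    using col_Suc_eq_iff Suc.prems by blast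
qed simp

text \<open>\<open>WL1_max\<close> ranges over graphs on natural numbers, so other vertex types have
  to be moved there. Colours do not mention vertices and are preserved literally.\<close>

lemma relabel:
  assumes f: "inj_on f V"
  defines "nb' \<equiv> \<lambda>x. map f (nb (inv_into V f x))"
  shows "adjacency_lists (f ` V) nb'"
    and "\<And>i v. v \<in> V \<Longrightarrow> colour_refinement (list_graph (f ` V) nb') i (f v) = col i v"
proof -
  have nb': "nb' (f v) = map f (nb v)" if "v \<in> V" for v
    using f that by (simp add: nb'_def)
  show adj: "adjacency_lists (f ` V) nb'"
  proof
    show "distinct (nb' x)" if x: "x \<in> f ` V" for x
    proof -
      obtain v where v: "v \<in> V" "x = f v"
        using x by blast
      then show ?thesis
        using nb_distinct inj_on_subset[OF f nb_subset] by (simp add: nb' distinct_map)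
    qed
    show "x \<in> set (nb' y)" if x: "x \<in> f ` V" and y: "y \<in> set (nb' x)" for x y
    proof -
      obtain v where v: "v \<in> V" "x = f v"
        using x by blast
      then obtain w where "w \<in> set (nb v)" "y = f w"
        using y nb' by auto
      then show ?thesis
        using v nb' nb_sym nb_subset by (metis imageI list.set_map subsetD)
    qed
    show "x \<notin> set (nb' x)" if x: "x \<in> f ` V" for x
    proof
      assume "x \<in> set (nb' x)"
      then obtain v w where "v \<in> V" "w \<in> set (nb v)" "f w = f v"
        using x nb' by force
      then show False
        using f nb_irrefl nb_subset by (metis inj_onD subsetD)
    qed
    show "set (nb' x) \<subseteq> f ` V" if x: "x \<in> f ` V" for x
      using x nb' nb_subset by fastforce
  qed (use finite_V in simp)
  interpret A': adjacency_lists "f ` V" nb'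
    by (rule adj)
  show "colour_refinement (list_graph (f ` V) nb') i (f v) = col i v" if "v \<in> V" for i v
    using that
  proof (induction i arbitrary: v)
    case (Suc i)
    have "image_mset (A'.col i) (mset (nb' (f v))) = image_mset (col i) (mset (nb v))"
      using Suc nb_subset[of v] by (auto simp: nb' multiset.map_comp intro!: image_mset_cong)
    then show ?case
      using Suc by (simp add: neighbourhood_list_graph A'.neighbourhood_list_graph)
  qed simp
qed

lemma less_WL1_maxI:
  fixes f :: "'a \<Rightarrow> nat"
  assumes inj: "inj_on f V" and uv: "u \<in> V" "v \<in> V" and "col r u = col r v" "col j u \<noteq> col j v"
    and "card V = n"
  shows "r < WL1_max n" 
proof -
  let ?nb = "\<lambda>x. map f (nb (inv_into V f x))"
  let ?G = "list_graph (f ` V) ?nb"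
  interpret A': adjacency_lists "f ` V" ?nb
    by (rule relabel(1)[OF inj])
  have "r < WL1 ?G"
    using assms relabel(2)[OF inj] by (intro A'.less_WL1_list_graphI[of "f u" "f v" r j]) auto
  also have "\<dots> \<le> WL1_max n"
    unfolding WL1_max_def
  proof (rule Max_ge[OF finite_WL1_values])
    show "WL1 ?G \<in> {WL1 G | G :: nat pair_pre_digraph. pair_graph G \<and> card (pverts G) = n}"
      using A'.pair_graph_list_graph card_image[OF inj] assms(6) by force
  qed
  finally show ?thesis .
qed

end

lemma WL1_max_less:
  assumes "n > 0"
  shows "WL1_max n < n"
proof -
  have "WL1_max n \<in> {WL1 G | G :: nat pair_pre_digraph. pair_graph G \<and> card (pverts G) = n}"
    unfolding WL1_max_def by (rule Max_in[OF finite_WL1_values WL1_values_nonempty])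
  then obtain G :: "nat pair_pre_digraph" where "WL1_max n = WL1 G" "card (pverts G) = n"
    by auto
  then show ?thesis
    using WL1_less_card[of G] assms by (metis card.empty card.infinite less_irrefl)
qed

subsection \<open>Small orders\<close>

text \<open>A new colour is the index of the first vertex with the same signature, which keeps
  colours small. Sorted lists stand for multisets, and the old colour is left out by
  \<open>colour_refinement_Suc_eq_iff\<close>.\<close>

definition refine_list :: "nat list list \<Rightarrow> nat list \<Rightarrow> nat list" where
  "refine_list adj xs =
    (let sigs = map (\<lambda>ns. sort (map ((!) xs) ns)) adj
     in map (\<lambda>s. length (takeWhile (\<lambda>t. t \<noteq> s) sigs)) sigs)"

lemma length_takeWhile_neq_eq_iff:
  assumes "x \<in> set xs" "y \<in> set xs"
  shows "length (takeWhile (\<lambda>t. t \<noteq> x) xs) = length (takeWhile (\<lambda>t. t \<noteq> y) xs) \<longleftrightarrow> x = y"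
proof -
  have "xs ! length (takeWhile (\<lambda>t. t \<noteq> z) xs) = z" if "z \<in> set xs" for z
    using that by (induction xs) auto
  then show ?thesis
    using assms by metis
qed

text \<open>The computed colours differ from those of \<open>col\<close> but induce the same
  partition in every round, so the bound can be checked by evaluation.\<close>

lemma less_WL1_max_by_refine_list:
  assumes adj: "adjacency_lists {..<length adj} ((!) adj)"
    and uv: "u < length adj" "v < length adj"
    and eq: "let xs = (refine_list adj ^^ r) (replicate (length adj) 0); ys = refine_list adj xs
      in xs ! u = xs ! v \<and> ys ! u \<noteq> ys ! v"
    and n: "length adj = n"
  shows "r < WL1_max n"
proof -
  interpret adjacency_lists "{..<length adj}" "(!) adj"
    by (rule adj)
  define xs where "xs i = (refine_list adj ^^ i) (replicate (length adj) 0)" for i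
  have "xs i ! x = xs i ! y \<longleftrightarrow> col i x = col i y" if "x < length adj" "y < length adj" for i x y
    using that
  proof (induction i arbitrary: x y)
    case (Suc i)
    let ?sig = "\<lambda>ns. sort (map ((!) (xs i)) ns)"
    have xs: "xs (Suc i) ! z = length (takeWhile (\<lambda>t. t \<noteq> ?sig (adj ! z)) (map ?sig adj))"
      if "z < length adj" for z
      using that by (simp add: xs_def refine_list_def Let_def)
    have "xs (Suc i) ! x = xs (Suc i) ! y \<longleftrightarrow> ?sig (adj ! x) = ?sig (adj ! y)"
      unfolding xs[OF Suc.prems(1)] xs[OF Suc.prems(2)]
      using Suc.prems by (intro length_takeWhile_neq_eq_iff) auto
    also have "\<dots> \<longleftrightarrow> image_mset ((!) (xs i)) (mset (adj ! x)) = image_mset ((!) (xs i)) (mset (adj ! y))"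
      by (metis mset_map mset_sort properties_for_sort sorted_sort)
    also have "\<dots> \<longleftrightarrow> image_mset (col i) (mset (adj ! x)) = image_mset (col i) (mset (adj ! y))"
      using Suc nb_subset by (intro iffI; elim image_mset_eq_coarser[where V = "{..<length adj}"]) auto
    also have "\<dots> \<longleftrightarrow> col (Suc i) x = col (Suc i) y"
      using col_Suc_eq_iff Suc.prems by auto
    finally show ?case .
  qed (simp add: xs_def)
  note * = this
  have "xs r ! u = xs r ! v" "xs (Suc r) ! u \<noteq> xs (Suc r) ! v"
    using eq by (simp_all add: xs_def Let_def)
  then have "col r u = col r v" "col (Suc r) u \<noteq> col (Suc r) v"
    using * uv by blast+
  then show ?thesis
    using uv n by (intro less_WL1_maxI[of id u v r "Suc r"]) auto
qed

lemma adjacency_lists_nthI: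
  assumes "\<forall>ns\<in>set adj. list_all (\<lambda>w. w < length adj) ns \<and> distinct ns"
    and "\<forall>v\<in>{..<length adj}. list_all (\<lambda>w. w \<noteq> v \<and> v \<in> set (adj ! w)) (adj ! v)"
  shows "adjacency_lists {..<length adj} ((!) adj)"
  using assms by unfold_locales (auto simp: list_all_iff)

text \<open>Both graphs were found by computer search. Adding an isolated vertex does not change the rounds.\<close>

definition graph10 :: "nat list list" where
  "graph10 = [[1, 2, 3, 6], [0, 4, 5, 7], [0, 3, 8], [0, 2, 9], [1, 6, 8], [1, 7, 9], [0, 4, 7],
    [1, 5, 6], [2, 4, 9], [3, 5, 8]]"

definition graph12 :: "nat list list" where
  "graph12 = [[2, 8, 9], [3, 10, 11], [0, 4], [1, 5], [2, 5, 6], [3, 4, 7], [4, 7, 8], [5, 6, 9],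
    [0, 6, 10], [0, 7, 11], [1, 8, 11], [1, 9, 10]]"

lemmas graph_eval = graph10_def graph12_def refine_list_def lessThan_nat_numeral lessThan_Suc

lemma less_WL1_max_10: "8 < WL1_max 10"
\<comment> \<open>Vertices 2 and 3 agree after round 8 and differ after round 9, so this graph
  forces \<open>WL1_max 10\<close> up to \<open>n - 1\<close>.\<close>
proof (rule less_WL1_max_by_refine_list[where adj = "graph10" and u = 2 and v = 3])
  show "adjacency_lists {..<length graph10} ((!) graph10)"
    by (rule adjacency_lists_nthI) (simp_all add: graph_eval)
qed (simp_all add: graph_eval numeral_eq_Suc)

lemma less_WL1_max_11: "8 < WL1_max 11"
proof (rule less_WL1_max_by_refine_list[where adj = "graph10 @ [[]]" and u = 2 and v = 3])
  show "adjacency_lists {..<length (graph10 @ [[]])} ((!) (graph10 @ [[]]))"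
    by (rule adjacency_lists_nthI) (simp_all add: graph_eval)
qed (simp_all add: graph_eval numeral_eq_Suc)

lemma less_WL1_max_12: "10 < WL1_max 12"
proof (rule less_WL1_max_by_refine_list[where adj = "graph12" and u = 10 and v = 11])
  show "adjacency_lists {..<length graph12} ((!) graph12)"
    by (rule adjacency_lists_nthI) (simp_all add: graph_eval)
qed (simp_all add: graph_eval numeral_eq_Suc)

lemma less_WL1_max_13: "10 < WL1_max 13"
proof (rule less_WL1_max_by_refine_list[where adj = "graph12 @ [[]]" and u = 10 and v = 11])
  show "adjacency_lists {..<length (graph12 @ [[]])} ((!) (graph12 @ [[]]))"
    by (rule adjacency_lists_nthI) (simp_all add: graph_eval)
qed (simp_all add: graph_eval numeral_eq_Suc)

subsection \<open>Certificates for slow refinement\<close>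

text \<open>Definable sets are unions of classes of the stable colouring.\<close>

inductive definable :: "'a set \<Rightarrow> ('a \<Rightarrow> 'a list) \<Rightarrow> 'a set \<Rightarrow> bool"
  for V nb where
  whole: "definable V nb V"
| diff: "definable V nb D \<Longrightarrow> definable V nb E \<Longrightarrow> definable V nb (D - E)"
| count: "definable V nb D \<Longrightarrow> definable V nb {v \<in> V. P (length (filter (\<lambda>w. w \<in> D) (nb v)))}"

lemma definable_inter:
  assumes "definable V nb D" "definable V nb E"
  shows "definable V nb (D \<inter> E)"
proof -
  have "definable V nb (D - (D - E))"
    using assms by (intro definable.diff)
  then show ?thesis
    by (simp add: Diff_Diff_Int)
qed

lemma definable_union:
  assumes "definable V nb D" "definable V nb E" "D \<subseteq> V" "E \<subseteq> V"
  shows "definable V nb (D \<union> E)"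
proof -
  have "definable V nb (V - ((V - D) - E))"
    using assms by (intro definable.diff definable.whole)
  moreover have "V - ((V - D) - E) = D \<union> E"
    using assms(3,4) by auto
  ultimately show ?thesis
    by simp
qed

lemma definable_neighbours:
  assumes "definable V nb D"
  shows "definable V nb {v \<in> V. \<exists>w\<in>D. w \<in> set (nb v)}"
proof -
  have "(\<exists>w\<in>D. w \<in> set (nb v)) \<longleftrightarrow> length (filter (\<lambda>w. w \<in> D) (nb v)) > 0" for v
    by (auto simp: filter_empty_conv)
  then show ?thesis
    using definable.count[OF assms, of "\<lambda>k. k > 0"] by simp
qed

context adjacency_lists
begin

lemma definable_degree: "definable V nb {v \<in> V. length (nb v) = k}"
proof -
  have "filter (\<lambda>w. w \<in> V) (nb v) = nb v" if "v \<in> V" for v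
    using nb_subset[OF that] by (auto simp: filter_id_conv)
  then have "{v \<in> V. length (filter (\<lambda>w. w \<in> V) (nb v)) = k} = {v \<in> V. length (nb v) = k}"
    by auto
  then show ?thesis
    using definable.count[OF definable.whole, of V nb "\<lambda>j. j = k"] by simp
qed

text \<open>A difference needs only the later of two rounds, and counting neighbours in
  \<open>D\<close> needs one round more than \<open>D\<close> itself. Definability thus proves that
  vertices are separated eventually, without determining when.\<close>

lemma definable_imp_col:
  assumes "definable V nb D"
  shows "\<exists>i. \<forall>u\<in>V. \<forall>v\<in>V. col i u = col i v \<longrightarrow> (u \<in> D \<longleftrightarrow> v \<in> D)"
  using assms
proof (induction rule: definable.induct)
  case (diff D E)
  then obtain i j where
    "\<forall>u\<in>V. \<forall>v\<in>V. col i u = col i v \<longrightarrow> (u \<in> D \<longleftrightarrow> v \<in> D)"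
    "\<forall>u\<in>V. \<forall>v\<in>V. col j u = col j v \<longrightarrow> (u \<in> E \<longleftrightarrow> v \<in> E)"
    by blast
  moreover have "col i u = col i v" "col j u = col j v" if "col (max i j) u = col (max i j) v" for u v
    using that by (auto intro: colour_refinement_eq_mono[rotated])
  ultimately show ?case
    by (intro exI[of _ "max i j"]) blast
next
  case (count D P)
  then obtain i where i: "\<forall>u\<in>V. \<forall>v\<in>V. col i u = col i v \<longrightarrow> (u \<in> D \<longleftrightarrow> v \<in> D)"
    by blast
  \<comment> \<open>The count depends only on the multiset of truth values of
    \<open>w \<in> D\<close>, which is coarser than the multiset of colours.\<close>
  have len: "length (filter (\<lambda>w. w \<in> D) (nb v)) = size (filter_mset id (image_mset (\<lambda>w. w \<in> D) (mset (nb v))))" for v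
    by (simp add: filter_mset_image_mset flip: mset_filter)
  have "length (filter (\<lambda>w. w \<in> D) (nb u)) = length (filter (\<lambda>w. w \<in> D) (nb v))"
    if "u \<in> V" "v \<in> V" "col (Suc i) u = col (Suc i) v" for u v
  proof -
    have "image_mset (col i) (mset (nb u)) = image_mset (col i) (mset (nb v))"
      using that col_Suc_eq_iff by blast
    then have "image_mset (\<lambda>w. w \<in> D) (mset (nb u)) = image_mset (\<lambda>w. w \<in> D) (mset (nb v))"
    proof (rule image_mset_eq_coarser[where V = V])
      show "set_mset (mset (nb u)) \<subseteq> V" "set_mset (mset (nb v)) \<subseteq> V"
        using that nb_subset by simp_all
    qed (use i in blast)
    then show ?thesis
      by (simp only: len)
  qed
  then show ?case
    by (intro exI[of _ "Suc i"]) (metis (no_types, lifting) mem_Collect_eq)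
qed auto

end

text \<open>Two independent certificates are combined: \<open>c\<close> keeps \<open>x\<close> and
  \<open>y\<close> together up to round \<open>r\<close>, and \<open>D\<close> separates them
  eventually.\<close>

lemma less_WL1_max_by_certificate:
  fixes nb :: "'a :: countable \<Rightarrow> 'a list"
  assumes "adjacency_lists V nb"
    and refine: "\<And>i u v. i < r \<Longrightarrow> u \<in> V \<Longrightarrow> v \<in> V \<Longrightarrow> c (Suc i) u = c (Suc i) v \<Longrightarrow>
      image_mset (c i) (mset (nb u)) = image_mset (c i) (mset (nb v))"
    and x: "x \<in> V" and y: "y \<in> V" and eq: "c r x = c r y"
    and D: "definable V nb D" "x \<in> D" "y \<notin> D"
  shows "r < WL1_max (card V)"
proof -
  interpret adjacency_lists V nb
    by fact
  obtain i where "\<forall>u\<in>V. \<forall>v\<in>V. col i u = col i v \<longrightarrow> (u \<in> D \<longleftrightarrow> v \<in> D)"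
    using definable_imp_col D(1) by blast
  then have "col i x \<noteq> col i y"
    using x y D by blast
  moreover have "col r x = col r y"
    by (rule col_eq_of_coarser[OF refine]) (use x y eq in auto)
  ultimately show ?thesis
    using x y by (intro less_WL1_maxI[where f = to_nat]) auto
qed

section \<open>Adding a hub\<close>

definition hub_nb :: "'a list \<Rightarrow> ('a \<Rightarrow> 'a list) \<Rightarrow> 'a option \<Rightarrow> 'a option list" where
  "hub_nb as nb v = (case v of None \<Rightarrow> map Some as
     | Some v \<Rightarrow> map Some (nb v) @ (if v \<in> set as then [None] else []))"

lemma hub_nb_simps [simp]:
  "hub_nb as nb None = map Some as"
  "hub_nb as nb (Some v) = map Some (nb v) @ (if v \<in> set as then [None] else [])"
  by (simp_all add: hub_nb_def)

lemma adjacency_lists_hub: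
  assumes "adjacency_lists V nb" "set as \<subseteq> V" "distinct as"
  shows "adjacency_lists (insert None (Some ` V)) (hub_nb as nb)"
proof -
  interpret adjacency_lists V nb
    by fact
  show ?thesis
    using assms(2,3) nb_subset nb_distinct nb_sym nb_irrefl finite_V
    by unfold_locales (fastforce simp: distinct_map split: if_splits)+
qed

text \<open>A hub joined to the vertices of degree 2 makes all other degrees equal, so that it is
  singled out in the first round and the partition by degrees appears one round later.\<close>

lemma less_WL1_max_by_certificate_hub:
  fixes nb :: "'a :: countable \<Rightarrow> 'a list"
  assumes adj: "adjacency_lists V nb"
    and refine: "\<And>i u v. i < r \<Longrightarrow> u \<in> V \<Longrightarrow> v \<in> V \<Longrightarrow> c (Suc i) u = c (Suc i) v \<Longrightarrow>
      image_mset (c i) (mset (nb u)) = image_mset (c i) (mset (nb v))"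
    and x: "x \<in> V" and y: "y \<in> V" and eq: "c r x = c r y"
    and D: "definable V nb D" "x \<in> D" "y \<notin> D"
    and as: "set as = {v \<in> V. length (nb v) = 2}" "distinct as" "length as \<noteq> 3"
    and degree: "\<And>v. v \<in> V \<Longrightarrow> length (nb v) \<in> {2, 3}"
  shows "Suc r < WL1_max (Suc (card V))"
proof -
  let ?V = "insert None (Some ` V)" and ?nb = "hub_nb as nb"
  interpret adjacency_lists V nb
    by fact
  interpret H: adjacency_lists ?V ?nb
    using as by (intro adjacency_lists_hub[OF adj]) auto
  \<comment> \<open>Everything is equal in round 0. From round 1 on the hub has its own colour and
    the other vertices use \<open>c\<close> with a delay of one round.\<close>
  define c' where "c' i v = (case v of None \<Rightarrow> if i = 0 then Inl True else Inl False
      | Some v \<Rightarrow> if i = 0 then Inl True else Inr (c (i - 1) v))" for i v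
  have c'_0: "c' 0 = (\<lambda>_. Inl True)"
    by (auto simp: c'_def fun_eq_iff split: option.splits)
  have c'_Suc [simp]: "c' (Suc i) None = Inl False" "c' (Suc i) (Some v) = Inr (c i v)" for i v
    by (simp_all add: c'_def)
  have "Suc r < WL1_max (card ?V)"
  proof (rule less_WL1_max_by_certificate[OF H.adjacency_lists_axioms,
        where c = c' and x = "Some x" and y = "Some y" and D = "Some ` D"])
    fix i u v
    assume i: "i < Suc r" and uv: "u \<in> ?V" "v \<in> ?V" and c': "c' (Suc i) u = c' (Suc i) v"
    show "image_mset (c' i) (mset (?nb u)) = image_mset (c' i) (mset (?nb v))"
    proof (cases "u = None \<or> v = None")
      case True
      then show ?thesis
        using c' uv by (auto split: option.splits)
    next
      case False
      then obtain u' v' where u': "u = Some u'" "u' \<in> V" and v': "v = Some v'" "v' \<in> V"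
        using uv by auto
      show ?thesis
      proof (cases i)
        case 0
        have "length (?nb (Some w)) = 3" if "w \<in> V" for w
          using degree[OF that] as(1) that by auto
        then show ?thesis
          using u' v' by (simp only: 0 c'_0 image_mset_const_eq size_mset)
      next
        case (Suc j)
        have nb_eq: "image_mset (c j) (mset (nb u')) = image_mset (c j) (mset (nb v'))"
          using refine[of j u' v'] c' u' v' i Suc by simp
        then have "length (nb u') = length (nb v')"
          by (metis size_image_mset size_mset)
        \<comment> \<open>Equal neighbour multisets give equal degrees, so either both vertices are
          joined to the hub or neither is.\<close>
        then have "u' \<in> set as \<longleftrightarrow> v' \<in> set as"
          using as(1) u' v' by simp
        moreover have "image_mset (c' i) (image_mset Some (mset (nb w))) =
            image_mset Inr (image_mset (c j) (mset (nb w)))" for w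
          by (simp add: multiset.map_comp comp_def Suc)
        ultimately show ?thesis
          using nb_eq u' v' by simp
      qed
    qed
  next
    have hub: "definable ?V ?nb {None}"
    proof -
      \<comment> \<open>All vertices but the hub have degree 3, and the hub has a different degree
        because \<open>length as \<noteq> 3\<close>.\<close>
      have "{v \<in> ?V. length (?nb v) = length as} = {None}"
        using degree as(1,3) by fastforce
      then show ?thesis
        using H.definable_degree[of "length as"] by simp
    qed
    then have "definable ?V ?nb (?V - {None})"
      by (intro definable.diff definable.whole)
    then have V: "definable ?V ?nb (Some ` V)"
      by (simp add: insert_Diff_if)
    show "definable ?V ?nb (Some ` D)"
      using D(1)
    proof (induction rule: definable.induct)
      case whole
      then show ?case
        by (rule V)
    next
      case (diff D E)
      then show ?case
        by (simp add: image_set_diff definable.diff)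
    next
      case (count D P)
      \<comment> \<open>The hub lies outside the image of \<open>D\<close>, so it does not disturb
        the counts.\<close>
      have "Some ` {v \<in> V. P (length (filter (\<lambda>w. w \<in> D) (nb v)))} =
          Some ` V \<inter> {v \<in> ?V. P (length (filter (\<lambda>w. w \<in> Some ` D) (?nb v)))}"
        by (auto simp: filter_map comp_def image_iff)
      then show ?case
        using definable_inter[OF V definable.count[OF count.IH, of P]] by simp
    qed
  qed (use x y eq D in auto)
  also have "card ?V = Suc (card V)"
    using finite_V by (simp add: card_image)
  finally show ?thesis .
qed

subsection \<open>The folded path of pairs\<close>

lemma length_filter_le_1:
  assumes "distinct (map g xs)" "\<And>x. P x \<Longrightarrow> g x = k"
  shows "length (filter P xs) \<le> 1"
  using assms by (induction xs) (auto simp: filter_empty_conv)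

text \<open>The arms run from pair \<open>a + 1\<close> down to \<open>0\<close>, from
  \<open>a + 2\<close> up to \<open>centre - 1\<close>, and from \<open>final\<close> down to
  \<open>centre + 1\<close>, with lengths \<open>a + 1\<close>, \<open>b + 1\<close> and
  \<open>b + 1\<close>. Reflection in \<open>centre\<close> exchanges \<open>a + 2\<close> and
  \<open>final\<close>.\<close>

locale folded_path =
  fixes a b :: nat
  assumes ab: "a \<le> Suc b" "b \<le> Suc a"
begin

abbreviation "centre \<equiv> a + b + 4"
abbreviation "final \<equiv> a + 2 * b + 6"

definition vertices :: "(nat \<times> bool) set" where
  "vertices = {..final} \<times> UNIV"

definition nbrs :: "nat \<times> bool \<Rightarrow> (nat \<times> bool) list" where
  "nbrs v = (case v of (p, s) \<Rightarrow>
     if p = 0 then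
       let x = (if s then centre + 1 else centre - 1) in [(1, s), (x, False), (x, True)]
     else if p = final then [(p - 1, s), (p, \<not> s)]
     else [(p - 1, s), (p + 1, s)] @
       (if p = centre - 1 then [(0, False)] else if p = centre + 1 then [(0, True)]
        else if p = a + 1 \<or> p = a + 2 then [] else [(p, \<not> s)]))"

text \<open>Ignoring the range of \<open>p\<close> makes symmetry and irreflexivity immediate;
  \<open>mem_nbrs_iff\<close> restores the range.\<close>

definition adj :: "nat \<times> bool \<Rightarrow> nat \<times> bool \<Rightarrow> bool" where
  "adj v w = (case (v, w) of ((p, s), (q, t)) \<Rightarrow>
     q = p + 1 \<and> t = s \<or> p = q + 1 \<and> t = s \<or>
     p = q \<and> t \<noteq> s \<and> p \<notin> {0, a + 1, a + 2, centre - 1, centre + 1} \<or>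
     p = 0 \<and> q = (if s then centre + 1 else centre - 1) \<or>
     q = 0 \<and> p = (if t then centre + 1 else centre - 1))"

lemma mem_nbrs_iff:
  assumes "v \<in> vertices"
  shows "w \<in> set (nbrs v) \<longleftrightarrow> w \<in> vertices \<and> adj v w"
proof -
  obtain p s q t where vw: "v = (p, s)" "w = (q, t)"
    by fastforce
  consider "p = 0" | "p = final" | "p = centre - 1" | "p = centre + 1" | "p \<in> {a + 1, a + 2}"
    | "p \<notin> {0, a + 1, a + 2, centre - 1, centre + 1, final}"
    by blast
  then show ?thesis
    by cases (use assms in \<open>auto simp: vw vertices_def nbrs_def adj_def Let_def\<close>)
qed

lemma adj_sym: "adj v w \<Longrightarrow> adj w v"
  by (auto simp: adj_def split: prod.splits)

lemma adj_irrefl: "\<not> adj v v"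
  by (cases v) (auto simp: adj_def)

lemma adjacency_lists_nbrs: "adjacency_lists vertices nbrs"
proof
  show "finite vertices"
    by (simp add: vertices_def)
  fix v assume v: "v \<in> vertices"
  show "set (nbrs v) \<subseteq> vertices"
    using mem_nbrs_iff[OF v] by blast
  show "w \<in> set (nbrs v) \<Longrightarrow> v \<in> set (nbrs w)" for w
    using mem_nbrs_iff v adj_sym by blast
  show "v \<notin> set (nbrs v)"
    using mem_nbrs_iff[OF v] adj_irrefl by blast
  show "distinct (nbrs v)"
    using v by (auto simp: nbrs_def vertices_def Let_def)
qed

lemma card_vertices: "card vertices = 2 * Suc final"
  by (simp add: vertices_def card_cartesian_product)

lemma length_nbrs:
  "length (nbrs (p, s)) = (if p \<in> {a + 1, a + 2, final} then 2 else 3)"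
  by (auto simp: nbrs_def Let_def)

section \<open>The classes of unsplit pairs\<close>

text \<open>
  \<open>quot i p\<close> represents the class of pair \<open>p\<close> after \<open>i\<close> rounds as long as no pair is split: the path is
  folded at its centre, then the arm \<open>0, \<dots>, a + 1\<close> is folded onto \<open>a + 2, a + 3, \<dots>\<close>, and finally all
  positions beyond the front \<open>a + 2 + i\<close> of the first wave are merged. The second wave, which leaves
  pair \<open>0\<close> in round \<open>b + 2\<close>, undoes both folds.
\<close>

definition quot :: "nat \<Rightarrow> nat \<Rightarrow> nat" where
  "quot i p =
    (let m = min p (2 * centre - p);
         q = (if b + 2 + m \<le> i then p else m);
         t = (if q \<le> a + 1 \<and> i < b + 2 + q then 2 * a + 3 - q else q)
     in if a + 2 \<le> t \<and> t \<le> centre then min t (a + 2 + i) else t)"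

text \<open>Neighbouring pairs, with multiplicity and without sides. The two vertices of pair
  \<open>0\<close> see different pairs, \<open>centre - 1\<close> and \<open>centre + 1\<close>;
  listing \<open>centre - 1\<close> for both is adequate while these two share a class.\<close>

definition quot_nbrs :: "nat \<Rightarrow> nat list" where
  "quot_nbrs p =
     (if p = 0 then [1, centre - 1, centre - 1]
      else if p = final then [p - 1, p]
      else [p - 1, p + 1] @
       (if p = centre - 1 \<or> p = centre + 1 then [0]
        else if p = a + 1 \<or> p = a + 2 then [] else [p]))"

definition qsig :: "nat \<Rightarrow> nat \<Rightarrow> nat multiset" where
  "qsig i p = image_mset (quot i) (mset (quot_nbrs p))"

lemma quot_le_centre:
  assumes "q \<le> centre"
  shows "quot i q =
    (let t = (if q \<le> a + 1 \<and> i < b + 2 + q then 2 * a + 3 - q else q)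
     in if a + 2 \<le> t \<and> t \<le> centre then min t (a + 2 + i) else t)"
proof -
  have "min q (2 * centre - q) = q"
    using assms by simp
  then show ?thesis
    by (simp only: quot_def Let_def if_cancel)
qed

lemma quot_mirror:
  assumes "i < b + 2 + q" "a + 2 \<le> q" "q \<le> centre"
  shows "quot i (2 * centre - q) = quot i q"
proof -
  have "min (2 * centre - q) (2 * centre - (2 * centre - q)) = q" "min q (2 * centre - q) = q"
    using assms(3) by simp_all
  moreover have "\<not> b + 2 + q \<le> i"
    using assms(1) by simp
  ultimately show ?thesis
    by (simp only: quot_def Let_def if_False)
qed

lemma quot_fold:
  assumes "i < b + 2 + q" "q \<le> a + 1"
  shows "quot i q = quot i (2 * a + 3 - q)"
proof -
  have "2 * a + 3 - q \<le> centre" "\<not> 2 * a + 3 - q \<le> a + 1"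
    using assms(2) ab by linarith+
  moreover have "q \<le> centre"
    using assms(2) by simp
  ultimately show ?thesis
    using assms by (simp only: quot_le_centre Let_def simp_thms if_True if_False)
qed

lemma quot_top:
  assumes "a + 2 + i \<le> q" "q \<le> centre"
  shows "quot i q = a + 2 + i"
  using assms by (simp add: quot_le_centre)

text \<open>The reflection in \<open>centre\<close> respects neighbourhoods. The bound on
  \<open>i\<close> is that of \<open>quot_mirror\<close> for the neighbour \<open>q - 1\<close>,
  which is unfolded one round before \<open>q\<close>.\<close>

lemma qsig_mirror:
  assumes "i + 1 < b + 2 + q" "a + 2 \<le> q" "q < centre"
  shows "qsig i (2 * centre - q) = qsig i q"
proof -
  have *: "quot i (2 * centre - q) = quot i q" "quot i (2 * centre - (q + 1)) = quot i (q + 1)"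
    using assms by (simp_all only: quot_mirror)
  consider "q = a + 2" | "q = centre - 1" | "a + 2 < q" "q < centre - 1"
    using assms by linarith
  then show ?thesis
  proof cases
    \<comment> \<open>The edge inside the last pair plays the part of the link from
      \<open>a + 2\<close> to \<open>a + 1\<close>: pair \<open>a + 1\<close> is folded onto
      \<open>a + 2\<close>, whose mirror image is the last pair.\<close>
    case 1
    have "quot i (2 * centre - q) = quot i (a + 1)"
      using assms 1 quot_mirror[of i q] quot_fold[of i "a + 1"] by simp
    moreover have "quot_nbrs (2 * centre - q) = [2 * centre - (q + 1), 2 * centre - q]"
      using 1 by (simp add: quot_nbrs_def)
    moreover have "quot_nbrs q = [a + 1, q + 1]"
      using 1 by (simp add: quot_nbrs_def)
    ultimately show ?thesis
      using *(2) by (simp only: qsig_def mset.simps image_mset_add_mset image_mset_empty add_mset_commute)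
  next
    case 2
    have "quot i (2 * centre - (q - 1)) = quot i (q - 1)"
      using assms 2 by (intro quot_mirror) auto
    moreover have "quot_nbrs (2 * centre - q) = [q + 1, 2 * centre - (q - 1), 0]"
      using 2 by (simp add: quot_nbrs_def)
    moreover have "quot_nbrs q = [q - 1, q + 1, 0]"
      using 2 by (simp add: quot_nbrs_def)
    ultimately show ?thesis
      by (simp only: qsig_def mset.simps image_mset_add_mset image_mset_empty add_mset_commute)
  next
    case 3
    have "quot i (2 * centre - (q - 1)) = quot i (q - 1)"
      using assms 3 by (intro quot_mirror) auto
    moreover have "quot_nbrs (2 * centre - q) = [2 * centre - (q + 1), 2 * centre - (q - 1), 2 * centre - q]"
      using 3 by (auto simp: quot_nbrs_def)
    moreover have "quot_nbrs q = [q - 1, q + 1, q]"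
      using 3 by (simp add: quot_nbrs_def)
    ultimately show ?thesis
      using * by (simp only: qsig_def mset.simps image_mset_add_mset image_mset_empty add_mset_commute)
  qed
qed

text \<open>Up to round \<open>b\<close> the front has not passed the pairs concerned. Apart from
  \<open>1\<close> and its image \<open>2 * a + 2\<close>, all neighbours on both sides lie in the
  top class.\<close>

lemma qsig_fold_0:
  assumes "i \<le> b"
  shows "qsig i 0 = qsig i (2 * a + 3)"
proof -
  have top: "quot i (centre - 1) = a + 2 + i" "quot i (2 * a + 3) = a + 2 + i"
    using assms ab by (intro quot_top; linarith)+
  have "quot i (2 * a + 4) = a + 2 + i"
  \<comment> \<open>For \<open>a = b + 1\<close> pair \<open>2 * a + 4\<close> is
    \<open>centre + 1\<close>, just past the centre, and is first reflected.\<close>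
  proof (cases "a \<le> b")
    case True
    then show ?thesis
      using assms ab by (intro quot_top; linarith)
  next
    case False
    then have "2 * a + 4 = 2 * centre - (centre - 1)"
      using ab by presburger
    moreover have "quot i (2 * centre - (centre - 1)) = quot i (centre - 1)"
      using assms by (intro quot_mirror; linarith)
    ultimately show ?thesis
      by (simp only: top)
  qed
  moreover have "quot i 1 = quot i (2 * a + 2)"
    using assms quot_fold[of i 1] by simp
  moreover have "quot i 0 = a + 2 + i"
    using assms quot_fold[of i 0] top by simp
  \<comment> \<open>Pair \<open>2 * a + 3\<close> is \<open>centre - 1\<close> exactly when
    \<open>a = b\<close>; then its third neighbour lies in pair \<open>0\<close> instead of in the
    pair itself.\<close>
  then have "quot i (if a = b then 0 else 2 * a + 3) = a + 2 + i"
    using top(2) by presburger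
  moreover have "quot_nbrs 0 = [1, centre - 1, centre - 1]"
    by (simp add: quot_nbrs_def)
  moreover have "quot_nbrs (2 * a + 3) = [2 * a + 2, 2 * a + 4, if a = b then 0 else 2 * a + 3]"
    unfolding quot_nbrs_def using ab by auto
  ultimately show ?thesis
    by (simp only: top qsig_def mset.simps image_mset_add_mset image_mset_empty)
qed

text \<open>The reflection of the first arm, which exchanges \<open>a + 1\<close> and
  \<open>a + 2\<close>, reverses predecessor and successor. The exceptions are \<open>q = 0\<close>
  and a pair whose image is \<open>centre - 1\<close>.\<close>

lemma qsig_fold:
  assumes "i + 1 < b + 2 + q" "q \<le> a + 1"
  shows "qsig i q = qsig i (2 * a + 3 - q)"
proof (cases "q = 0")
  case True
  then show ?thesis
    using assms qsig_fold_0 by simp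
next
  case False
  have "2 * a + 3 - (q - 1) = 2 * a + 3 - q + 1"
    using False assms(2) by linarith
  then have *: "quot i (q - 1) = quot i (2 * a + 3 - q + 1)" "quot i q = quot i (2 * a + 3 - q)"
    using assms quot_fold[of i "q - 1"] quot_fold[of i q] by simp_all
  consider "q = a + 1" | "q < a + 1" "2 * a + 3 - q = centre - 1" | "q < a + 1" "2 * a + 3 - q \<noteq> centre - 1"
    using assms by linarith
  then show ?thesis
  proof cases
    case 1
    have "quot_nbrs q = [q - 1, 2 * a + 3 - q]" "quot_nbrs (2 * a + 3 - q) = [q, 2 * a + 3 - q + 1]"
      using 1 ab False by (simp_all add: quot_nbrs_def)
    then show ?thesis
      using * by (simp only: qsig_def mset.simps image_mset_add_mset image_mset_empty add_mset_commute)
  next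
    \<comment> \<open>Only \<open>q = 1\<close> with \<open>a = b + 1\<close> remains. The image has
      an edge to pair \<open>0\<close> where pair \<open>1\<close> has an inner edge, but
      \<open>centre - 1\<close> and \<open>centre\<close> are both still in the top class.\<close>
    case 2
    have q: "q = 1"
      using 2 ab False by linarith
    then have ab': "a = Suc b"
      using 2 by linarith
    have "quot i 2 = quot i (centre - 2)"
      using assms 2 q quot_fold[of i 2] by simp
    moreover have "quot i 1 = quot i (centre - 1)"
      using assms 2 q quot_fold[of i 1] by simp
    moreover have "quot i (centre - 1) = a + 2 + i" "quot i centre = a + 2 + i"
      using assms q by (intro quot_top; linarith)+
    moreover have "quot_nbrs 1 = [0, 2, 1]" "quot_nbrs (centre - 1) = [centre - 2, centre, 0]"
      unfolding quot_nbrs_def using ab' 2 q by simp_all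
    ultimately show ?thesis
      unfolding 2(2) unfolding q
      by (simp only: qsig_def mset.simps image_mset_add_mset image_mset_empty add_mset_commute)
  next
    case 3
    then have "quot i (q + 1) = quot i (2 * a + 3 - q - 1)"
      using assms quot_fold[of i "q + 1"] by simp
    moreover have "2 * a + 3 - q < centre - 1"
      using 3 ab False by linarith
    then have "quot_nbrs q = [q - 1, q + 1, q]"
      "quot_nbrs (2 * a + 3 - q) = [2 * a + 3 - q - 1, 2 * a + 3 - q + 1, 2 * a + 3 - q]"
      using 3 assms ab False by (auto simp: quot_nbrs_def)
    ultimately show ?thesis
      using * by (simp only: qsig_def mset.simps image_mset_add_mset image_mset_empty add_mset_commute)
  qed
qed

text \<open>Strictly beyond the front all neighbours are merged, including pair \<open>0\<close> as
  a neighbour of \<open>centre - 1\<close>, which is still folded onto a pair in the top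
  class.\<close>

lemma qsig_top:
  assumes "a + 2 + i < q" "q \<le> centre"
  shows "qsig i q = {#a + 2 + i, a + 2 + i, a + 2 + i#}"
proof -
  have "quot i (q - 1) = a + 2 + i" "quot i q = a + 2 + i"
    using assms by (simp_all add: quot_top)
  moreover have "quot i (q + 1) = a + 2 + i"
    using assms quot_mirror[of i "centre - 1"] quot_top[of i "centre - 1"] quot_top[of i "q + 1"]
    by (cases "q = centre") (simp_all add: numeral_eq_Suc)
  moreover have "quot i 0 = a + 2 + i" if "q = centre - 1"
    using that assms ab by (simp add: quot_def)
  ultimately show ?thesis
    using assms by (auto simp: qsig_def quot_nbrs_def)
qed

text \<open>The three layers of \<open>quot\<close>, namely truncation at the front, fold of the
  first arm and fold at the centre, are removed one at a time; each preserves the signature of the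
  previous round.\<close>

lemma qsig_quot:
  assumes "p \<le> final"
  shows "qsig i (quot (Suc i) p) = qsig i p"
proof -
  define m where "m = min p (2 * centre - p)"
  define q where "q = (if b + 2 + m \<le> Suc i then p else m)"
  define t where "t = (if q \<le> a + 1 \<and> Suc i < b + 2 + q then 2 * a + 3 - q else q)"
  have quot: "quot (Suc i) p = (if a + 2 \<le> t \<and> t \<le> centre then min t (a + 2 + Suc i) else t)"
    by (simp add: quot_def Let_def m_def q_def t_def)
  have "qsig i (quot (Suc i) p) = qsig i t"
    using qsig_top[of i t] qsig_top[of i "a + 2 + Suc i"] by (auto simp: quot min_def)
  also have "\<dots> = qsig i q"
    using qsig_fold[of i q] by (auto simp: t_def)
  also have "\<dots> = qsig i p"
    using qsig_mirror[of i m] assms by (auto simp: q_def m_def min_def)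
  finally show ?thesis .
qed

section \<open>The splitting of the pairs\<close>

text \<open>The third wave splits pair \<open>p\<close> in round \<open>final + p\<close>.\<close>

definition rep :: "nat \<Rightarrow> nat \<times> bool \<Rightarrow> nat \<times> bool" where
  "rep i v = (case v of (p, s) \<Rightarrow> if final + p \<le> i then (p, s) else (quot i p, False))"

text \<open>The fold at the centre is undone last, by round \<open>b + 2 + centre\<close>, which
  equals \<open>final\<close>.\<close>

lemma quot_id:
  assumes "final \<le> i" "p \<le> final"
  shows "quot i p = p"
proof -
  have "p \<le> centre \<or> 2 * centre - p \<le> centre"
    by presburger
  then have "min p (2 * centre - p) \<le> centre"
    by (simp only: min_le_iff_disj)
  then have "b + 2 + min p (2 * centre - p) \<le> i"
    using assms(1) by linarith
  moreover have "min p (a + 2 + i) = p"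
    using assms by simp
  moreover have "\<not> (p \<le> a + 1 \<and> i < b + 2 + p)"
    using assms(1) by linarith
  ultimately show ?thesis
    by (simp only: quot_def Let_def if_True if_False if_cancel)
qed

lemma quot_le_final:
  assumes "p \<le> final"
  shows "quot i p \<le> final"
proof -
  define q where "q = (if b + 2 + min p (2 * centre - p) \<le> i then p else min p (2 * centre - p))"
  define t where "t = (if q \<le> a + 1 \<and> i < b + 2 + q then 2 * a + 3 - q else q)"
  have "q \<le> final"
    using assms by (simp add: q_def min.coboundedI1)
  moreover have "2 * a + 3 - q \<le> final"
    using ab by linarith
  ultimately have "t \<le> final"
    by (simp only: t_def split: if_split) blast
  moreover have "quot i p = (if a + 2 \<le> t \<and> t \<le> centre then min t (a + 2 + i) else t)"
    by (simp only: quot_def Let_def q_def t_def)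
  ultimately show ?thesis
    by (simp add: min.coboundedI1)
qed

text \<open>No pair is split yet, so sides do not matter. For pair \<open>0\<close> the bound on
  \<open>i\<close> ensures that \<open>centre - 1\<close> and \<open>centre + 1\<close> still share
  a class.\<close>

lemma rep_nbrs_early:
  assumes "i < final" "p \<le> final" "Suc i < final + p"
  shows "image_mset (rep i) (mset (nbrs (p, s))) = image_mset (\<lambda>q. (q, False)) (qsig i p)"
proof (cases "p = 0")
  case True
  have "quot i (centre + 1) = quot i (centre - 1)"
    using assms True quot_mirror[of i "centre - 1"] by (simp add: numeral_eq_Suc)
  then show ?thesis
    using assms True by (simp add: nbrs_def quot_nbrs_def qsig_def rep_def Let_def)
next
  case False
  have rep: "rep i (q, t) = (quot i q, False)" if "p \<le> q + 1 \<or> q = 0" for q t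
    using that assms by (auto simp: rep_def)
  consider "p = final" | "p = centre - 1" | "p = centre + 1" | "p \<in> {a + 1, a + 2}"
    | "p \<notin> {0, a + 1, a + 2, centre - 1, centre + 1, final}"
    using False by blast
  then show ?thesis
    by cases (use False in \<open>auto simp: nbrs_def quot_nbrs_def qsig_def rep\<close>)
qed

text \<open>Pair \<open>p - 1\<close> is not split yet, hence neither are \<open>p\<close> and
  \<open>p + 1\<close>. The early split of pair \<open>0\<close> does no harm at
  \<open>centre - 1\<close> and \<open>centre + 1\<close>, because both vertices of such a pair see
  the same vertex of pair \<open>0\<close>.\<close>

lemma rep_nbrs_late:
  assumes "final \<le> i" "p \<le> final" "Suc i < final + p"
  shows "image_mset (rep i) (mset (nbrs (p, s))) = image_mset (rep i) (mset (nbrs (p, False)))"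
proof -
  have rep: "rep i (q, t) = rep i (q, False)" if "p \<le> q + 1" for q t
    using that assms by (auto simp: rep_def)
  consider "p = final" | "p = centre - 1" | "p = centre + 1" | "p \<in> {a + 1, a + 2}"
    | "p \<notin> {0, a + 1, a + 2, centre - 1, centre + 1, final}"
    using assms by fastforce
  then show ?thesis
    by cases (use assms rep[of "p - 1" s] rep[of "p + 1" s] rep[of p "\<not> s"] rep[of p True]
        in \<open>auto simp: nbrs_def\<close>)
qed

lemma rep_nbrs_rep:
  assumes "v \<in> vertices"
  shows "image_mset (rep i) (mset (nbrs (rep (Suc i) v))) = image_mset (rep i) (mset (nbrs v))"
proof -
  obtain p s where v: "v = (p, s)" "p \<le> final"
    using assms by (auto simp: vertices_def)
  consider "final + p \<le> Suc i" | "Suc i < final + p" "final \<le> i" | "Suc i < final + p" "i < final"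
    by linarith
  then show ?thesis
  proof cases
    case 1
    then show ?thesis
      by (simp add: rep_def v)
  next
    case 2
    then show ?thesis
      using rep_nbrs_late[of i p s] v by (simp add: rep_def quot_id)
  next
    case 3
    let ?q = "quot (Suc i) p"
    \<comment> \<open>Only \<open>Suc i = final\<close> needs care: there \<open>?q\<close> must not
      be \<open>0\<close>, and it equals \<open>p\<close> because all folds are gone.\<close>
    have "Suc i < final + ?q"
    proof (cases "Suc i = final")
      case True
      then show ?thesis
        using 3 v quot_id[of "Suc i" p] by simp
    qed (use 3 in linarith)
    moreover have "rep (Suc i) v = (?q, False)"
      using 3 by (simp add: rep_def v)
    ultimately show ?thesis
      using 3 v quot_le_final[OF v(2)] by (simp add: rep_nbrs_early qsig_quot)
  qed
qed

lemma rep_refine: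
  assumes "u \<in> vertices" "v \<in> vertices" "rep (Suc i) u = rep (Suc i) v"
  shows "image_mset (rep i) (mset (nbrs u)) = image_mset (rep i) (mset (nbrs v))"
  using rep_nbrs_rep[OF assms(1), of i] rep_nbrs_rep[OF assms(2), of i] assms(3) by simp

section \<open>Definability of single vertices\<close>

abbreviation "dfn \<equiv> definable vertices nbrs"

lemma definable_adj:
  assumes "dfn D" "D \<subseteq> vertices"
  shows "dfn {v \<in> vertices. \<exists>w\<in>D. adj v w}"
proof -
  have "{v \<in> vertices. \<exists>w\<in>D. w \<in> set (nbrs v)} = {v \<in> vertices. \<exists>w\<in>D. adj v w}"
    using mem_nbrs_iff assms(2) by blast
  then show ?thesis
    using definable_neighbours[OF assms(1)] by simp
qed

text \<open>This is the distance from the vertices of degree 2, as \<open>lev_adj\<close> and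
  \<open>lev_pred\<close> together show.\<close>

definition lev :: "nat \<Rightarrow> nat" where
  "lev p = (if p \<le> a + 1 then a + 1 - p else if p \<le> centre then p - (a + 2) else final - p)"

text \<open>Along the path this is clear, and the edges at pair \<open>0\<close> join levels
  \<open>a + 1\<close> and \<open>b + 1\<close>, which differ by at most 1.\<close>

lemma lev_adj:
  assumes "adj v w" "v \<in> vertices" "w \<in> vertices"
  shows "lev (fst v) \<le> Suc (lev (fst w))"
proof -
  have step: "lev p \<le> Suc (lev (Suc p))" "lev (Suc p) \<le> Suc (lev p)" if "Suc p \<le> final" for p
    using that by (auto simp: lev_def)
  have jump: "lev (centre - 1) = b + 1" "lev (centre + 1) = b + 1" "lev 0 = a + 1"
    by (auto simp: lev_def)
  show ?thesis
    using assms step jump ab by (cases v; cases w) (auto simp: adj_def vertices_def split: if_splits)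
qed

lemma lev_pred:
  assumes "v \<in> vertices" "lev (fst v) \<noteq> 0"
  shows "\<exists>w\<in>vertices. adj v w \<and> lev (fst w) < lev (fst v)"
proof -
  obtain p s where v: "v = (p, s)" "p \<le> final"
    using assms(1) by (auto simp: vertices_def)
  consider "p \<le> a" | "a + 2 < p" "p \<le> centre" | "centre < p" "p < final"
    using assms(2) v by (fastforce simp: lev_def split: if_splits)
  then show ?thesis
  proof cases
    case 1
    then show ?thesis
      by (intro bexI[of _ "(p + 1, s)"]) (auto simp: v adj_def lev_def vertices_def)
  next
    case 2
    then show ?thesis
      by (intro bexI[of _ "(p - 1, s)"]) (auto simp: v adj_def lev_def vertices_def)
  next
    case 3
    then show ?thesis
      by (intro bexI[of _ "(p + 1, s)"]) (auto simp: v adj_def lev_def vertices_def)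
  qed
qed

lemma definable_lev_le: "dfn {v \<in> vertices. lev (fst v) \<le> l}"
proof (induction l)
  case 0
  have "{v \<in> vertices. length (nbrs v) = 2} = {v \<in> vertices. lev (fst v) \<le> 0}"
    by (auto simp: length_nbrs vertices_def lev_def split: if_splits)
  then show ?case
    using adjacency_lists.definable_degree[OF adjacency_lists_nbrs, of 2] by simp
next
  case (Suc l)
  let ?L = "\<lambda>l. {v \<in> vertices. lev (fst v) \<le> l}"
  have "?L (Suc l) = ?L l \<union> {v \<in> vertices. \<exists>w\<in>?L l. adj v w}" (is "_ = ?R")
  proof
    show "?L (Suc l) \<subseteq> ?R"
    proof
      fix v assume v: "v \<in> ?L (Suc l)"
      show "v \<in> ?R"
      proof (cases "lev (fst v) = 0")
        case False
        then obtain w where "w \<in> vertices" "adj v w" "lev (fst w) < lev (fst v)"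
          using lev_pred v by blast
        moreover from this have "w \<in> ?L l"
          using v by simp
        ultimately show ?thesis
          using v by blast
      qed (use v in simp)
    qed
    show "?R \<subseteq> ?L (Suc l)"
      using lev_adj by fastforce
  qed
  moreover have "dfn ?R"
    using Suc.IH by (intro definable_union definable_adj) auto
  ultimately show ?case
    by simp
qed

lemma definable_lev: "dfn {v \<in> vertices. lev (fst v) = Suc l}"
proof -
  have "{v \<in> vertices. lev (fst v) = Suc l} =
      {v \<in> vertices. lev (fst v) \<le> Suc l} - {v \<in> vertices. lev (fst v) \<le> l}"
    by auto
  then show ?thesis
    using definable_lev_le by (simp add: definable.diff)
qed

definition pair_at :: "nat \<Rightarrow> (nat \<times> bool) set" where
  "pair_at p = {v \<in> vertices. fst v = p}"

text \<open>Pair \<open>0\<close> is characterised by two neighbours on level \<open>b + 1\<close>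
  and none on level \<open>b + 2\<close>. Elsewhere the neighbours' levels are distinct, except at
  \<open>centre\<close> and next to it, where a neighbour in pair \<open>centre\<close> has level
  \<open>b + 2\<close>.\<close>

lemma definable_pair_at_0: "dfn (pair_at 0)"
proof -
  let ?L = "\<lambda>l. {v \<in> vertices. lev (fst v) = Suc l}"
  let ?count = "\<lambda>v. length (filter (\<lambda>w. w \<in> ?L b) (nbrs v))"
  have lev_jump: "lev (centre - 1) = Suc b" "lev (centre + 1) = Suc b" "lev centre = Suc (Suc b)"
    by (simp_all add: lev_def)
  have "{v \<in> vertices. 2 \<le> ?count v} - {v \<in> vertices. \<exists>w\<in>?L (Suc b). adj v w} = pair_at 0"
  proof (intro set_eqI iffI)
    fix v assume "v \<in> pair_at 0"
    then obtain s where v: "v = (0, s)"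
      by (cases v) (auto simp: pair_at_def)
    have "2 \<le> ?count v"
      using lev_jump by (simp add: v nbrs_def Let_def vertices_def)
    moreover have "lev 1 \<noteq> Suc (Suc b)"
      using ab by (simp add: lev_def)
    then have "\<not> (\<exists>w\<in>?L (Suc b). adj v w)"
      using lev_jump by (auto simp: v adj_def split: if_splits)
    ultimately show "v \<in> {v \<in> vertices. 2 \<le> ?count v} - {v \<in> vertices. \<exists>w\<in>?L (Suc b). adj v w}"
      by (simp add: v vertices_def)
  next
    fix v assume "v \<in> {v \<in> vertices. 2 \<le> ?count v} - {v \<in> vertices. \<exists>w\<in>?L (Suc b). adj v w}"
    then obtain p s where v: "v = (p, s)" "p \<le> final" and two: "2 \<le> ?count (p, s)"
      and top: "\<not> (\<exists>w\<in>?L (Suc b). adj (p, s) w)"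
      by (auto simp: vertices_def)
    have top': False if "adj (p, s) (centre, t)" for t
    proof -
      have "(centre, t) \<in> ?L (Suc b)"
        using lev_jump by (simp add: vertices_def)
      then show False
        using top that by blast
    qed
    have "p \<noteq> centre - 1" "p \<noteq> centre + 1" "p \<noteq> centre"
      using top'[of s] top'[of "\<not> s"] by (auto simp: adj_def)
    moreover have distinct: "\<not> distinct (map (lev \<circ> fst) (nbrs (p, s)))"
      using two length_filter_le_1[of "lev \<circ> fst" "nbrs (p, s)" "\<lambda>w. w \<in> ?L b" "Suc b"] by fastforce
    have False if "0 < p" "p \<le> a"
    proof -
      have "lev (p - 1) = a + 2 - p" "lev p = a + 1 - p" "lev (p + 1) = a - p"
        using that by (simp_all add: lev_def)
      then show False
        using distinct that by (simp add: nbrs_def) linarith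
    qed
    moreover have "p \<noteq> a + 1" "p \<noteq> a + 2"
      using distinct by (auto simp: nbrs_def lev_def)
    moreover have False if "a + 2 < p" "p < centre - 1"
    proof -
      have "lev (p - 1) = p - (a + 3)" "lev p = p - (a + 2)" "lev (p + 1) = p - (a + 1)"
        using that by (auto simp: lev_def)
      then show False
        using distinct that by (auto simp: nbrs_def)
    qed
    moreover have False if "centre + 1 < p" "p < final"
    proof -
      have "lev (p - 1) = final + 1 - p" "lev p = final - p" "lev (p + 1) = final - (p + 1)"
        using that by (auto simp: lev_def)
      then show False
        using distinct that by (auto simp: nbrs_def)
    qed
    moreover have "p \<noteq> final"
      using distinct by (auto simp: nbrs_def lev_def)
    ultimately have "p = 0"
      using v(2) by presburger
    then show "v \<in> pair_at 0"
      by (simp add: v pair_at_def vertices_def)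
  qed
  moreover have "dfn ({v \<in> vertices. 2 \<le> ?count v} - {v \<in> vertices. \<exists>w\<in>?L (Suc b). adj v w})"
    using definable.count[OF definable_lev[of b], of "\<lambda>k. 2 \<le> k"]
    by (intro definable.diff definable_adj definable_lev) auto
  ultimately show ?thesis
    by simp
qed

text \<open>Level \<open>b + 2\<close> consists of the central pair and, if
  \<open>a = b + 1\<close>, also of pair \<open>0\<close>.\<close>

lemma definable_pair_at_centre: "dfn (pair_at centre)"
proof -
  have "{v \<in> vertices. lev (fst v) = Suc (Suc b)} - pair_at 0 = pair_at centre"
    using ab by (auto simp: pair_at_def lev_def vertices_def split: if_splits)
  then show ?thesis
    using definable.diff[OF definable_lev definable_pair_at_0] by metis
qed

lemma pair_at_subset: "pair_at p \<subseteq> vertices"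
  by (auto simp: pair_at_def)

lemma mem_pair_at: "(p, s) \<in> pair_at q \<longleftrightarrow> p = q \<and> q \<le> final"
  by (auto simp: pair_at_def vertices_def)

definition near :: "nat \<Rightarrow> (nat \<times> bool) set" where
  "near q = {v \<in> vertices. \<exists>w\<in>pair_at q. adj v w}"

lemma mem_near:
  assumes "q \<le> final"
  shows "(p, s) \<in> near q \<longleftrightarrow> p \<le> final \<and>
    (p + 1 = q \<or> p = q + 1 \<or> p = q \<and> p \<notin> {0, a + 1, a + 2, centre - 1, centre + 1} \<or>
     p = 0 \<and> q = (if s then centre + 1 else centre - 1) \<or>
     q = 0 \<and> (p = centre - 1 \<or> p = centre + 1))"
proof -
  have "(p, s) \<in> near q \<longleftrightarrow> p \<le> final \<and> (\<exists>t. adj (p, s) (q, t))"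
    using assms by (auto simp: near_def vertices_def Bex_def mem_pair_at)
  also have "(\<exists>t. adj (p, s) (q, t)) \<longleftrightarrow>
    (p + 1 = q \<or> p = q + 1 \<or> p = q \<and> p \<notin> {0, a + 1, a + 2, centre - 1, centre + 1} \<or>
     p = 0 \<and> q = (if s then centre + 1 else centre - 1) \<or>
     q = 0 \<and> (p = centre - 1 \<or> p = centre + 1))"
    by (cases s) (auto simp: adj_def ex_bool_eq)
  finally show ?thesis .
qed

lemma definable_near: "dfn (pair_at q) \<Longrightarrow> dfn (near q)"
  unfolding near_def by (rule definable_adj[OF _ pair_at_subset])

text \<open>Each pair is found from its predecessors as the new neighbours of the last one. Pair
  \<open>1\<close> is told from \<open>centre - 1\<close> and \<open>centre + 1\<close> by not being
  adjacent to \<open>centre\<close>; pair \<open>0\<close> is removed because these two lead back to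
  it.\<close>

lemma definable_pair_at: "p \<le> final \<Longrightarrow> dfn (pair_at p)"
proof (induction p rule: less_induct)
  case (less p)
  consider "p = 0" | "p = 1" | q where "p = Suc (Suc q)"
    by (metis One_nat_def not0_implies_Suc)
  then show ?case
  proof cases
    case 1
    then show ?thesis
      by (simp add: definable_pair_at_0)
  next
    case 2
    have "v \<in> near 0 - near centre \<longleftrightarrow> v \<in> pair_at 1" for v
      by (cases v) (auto simp: mem_near mem_pair_at)
    then have "near 0 - near centre = pair_at 1"
      by blast
    then show ?thesis
      using 2 definable.diff[OF definable_near definable_near,
          OF definable_pair_at_0 definable_pair_at_centre] by simp
  next
    case 3
    have "v \<in> near (Suc q) - pair_at (Suc q) - pair_at q - pair_at 0 \<longleftrightarrow> v \<in> pair_at p" for v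
      using less.prems 3 by (cases v) (auto simp: mem_near mem_pair_at)
    then have "near (Suc q) - pair_at (Suc q) - pair_at q - pair_at 0 = pair_at p"
      by blast
    moreover have "dfn (near (Suc q) - pair_at (Suc q) - pair_at q - pair_at 0)"
      using less 3 by (intro definable.diff definable_near) auto
    ultimately show ?thesis
      by simp
  qed
qed

text \<open>The vertex of pair \<open>0\<close> adjacent to \<open>centre - 1\<close> is singled
  out, and the matchings carry its side along the path.\<close>

lemma definable_vertex: "p \<le> final \<Longrightarrow> dfn {(p, False)}"
proof (induction p)
  case 0
  have "v \<in> pair_at 0 \<inter> near (centre - 1) \<longleftrightarrow> v = (0, False)" for v
    by (cases v) (auto simp: mem_near mem_pair_at)
  then have "pair_at 0 \<inter> near (centre - 1) = {(0, False)}"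
    by blast
  moreover have "dfn (pair_at 0 \<inter> near (centre - 1))"
    by (intro definable_inter definable_near definable_pair_at) auto
  ultimately show ?case
    by simp
next
  case (Suc p)
  have "v \<in> pair_at (Suc p) \<inter> {v \<in> vertices. \<exists>w\<in>{(p, False)}. adj v w} \<longleftrightarrow> v = (Suc p, False)" for v
    using Suc.prems by (cases v) (auto simp: mem_pair_at vertices_def adj_def)
  then have "pair_at (Suc p) \<inter> {v \<in> vertices. \<exists>w\<in>{(p, False)}. adj v w} = {(Suc p, False)}"
    by blast
  moreover have "dfn (pair_at (Suc p) \<inter> {v \<in> vertices. \<exists>w\<in>{(p, False)}. adj v w})"
    using Suc by (intro definable_inter definable_adj definable_pair_at) (auto simp: vertices_def)
  ultimately show ?case
    by simp
qed

section \<open>Lower bounds for both parities and the conclusion\<close>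

lemma rep_final_eq: "rep (2 * final - 1) (final, False) = rep (2 * final - 1) (final, True)"
  by (simp add: rep_def)

lemma less_WL1_max_even: "2 * final - 1 < WL1_max (2 * final + 2)"
proof -
  have "2 * final - 1 < WL1_max (card vertices)"
  proof (rule less_WL1_max_by_certificate[where c = rep and x = "(final, False)" and y = "(final, True)"])
    show "adjacency_lists vertices nbrs"
      by (rule adjacency_lists_nbrs)
    show "rep (2 * final - 1) (final, False) = rep (2 * final - 1) (final, True)"
      by (rule rep_final_eq)
    show "dfn {(final, False)}"
      by (simp add: definable_vertex)
  qed (auto simp: vertices_def intro: rep_refine)
  then show ?thesis
    by (simp add: card_vertices)
qed

lemma less_WL1_max_odd: "2 * final < WL1_max (2 * final + 3)"
proof -
  have "Suc (2 * final - 1) < WL1_max (Suc (card vertices))"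
  proof (rule less_WL1_max_by_certificate_hub[where c = rep and x = "(final, False)" and y = "(final, True)"])
    show "adjacency_lists vertices nbrs"
      by (rule adjacency_lists_nbrs)
    show "rep (2 * final - 1) (final, False) = rep (2 * final - 1) (final, True)"
      by (rule rep_final_eq)
    show "dfn {(final, False)}"
      by (simp add: definable_vertex)
    \<comment> \<open>These are six vertices, so the hub has degree 6.\<close>
    show "set (List.product [a + 1, a + 2, final] [False, True]) = {v \<in> vertices. length (nbrs v) = 2}"
      by (auto simp: length_nbrs vertices_def)
    show "distinct (List.product [a + 1, a + 2, final] [False, True])"
      by simp
    show "length (nbrs v) \<in> {2, 3}" for v
      by (cases v) (simp add: length_nbrs)
  qed (auto simp: vertices_def intro: rep_refine)
  then show ?thesis
    by (simp add: card_vertices numeral_eq_Suc)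
qed

end

text \<open>The residue of \<open>m - 7\<close> modulo 3 decides whether \<open>a\<close> and
  \<open>b\<close> are equal or which of them is larger by 1.\<close>

lemma folded_path_parameters:
  assumes "7 \<le> (m :: nat)"
  obtains a b where "folded_path a b" "m = a + 2 * b + 7"
proof -
  define k where "k = (m - 7) div 3"
  have "m - 7 = 3 * k + (m - 7) mod 3" "(m - 7) mod 3 \<in> {0, 1, 2}"
    by (auto simp: k_def)
  then consider "m - 7 = k + 2 * k" | "m - 7 = Suc k + 2 * k" | "m - 7 = k + 2 * Suc k"
    by fastforce
  then show thesis
  proof cases
    case 1
    then show thesis
      using assms by (intro that[of k k]) (simp_all add: folded_path_def)
  next
    case 2
    then show thesis
      using assms by (intro that[of "Suc k" k]) (simp_all add: folded_path_def)
  next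
    case 3
    then show thesis
      using assms by (intro that[of k "Suc k"]) (simp_all add: folded_path_def)
  qed
qed

theorem theorem2:
  fixes n :: nat
  assumes "n \<ge> 10"
  shows "WL1_max n \<in> {n - 2, n - 1}"
proof -
  have "n - 3 < WL1_max n"
  proof (cases "n < 14")
    case True
    then consider "n = 10" | "n = 11" | "n = 12" | "n = 13"
      using assms by linarith
    then show ?thesis
      using less_WL1_max_10 less_WL1_max_11 less_WL1_max_12 less_WL1_max_13 by cases simp_all
  next
    case False
    \<comment> \<open>There are \<open>n div 2\<close> pairs, and the smallest folded path, with
      \<open>a = b = 0\<close>, has seven.\<close>
    then have "7 \<le> n div 2"
      by simp
    then obtain a b where params: "folded_path a b" "n div 2 = a + 2 * b + 7"
      by (rule folded_path_parameters)
    interpret folded_path a b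
      by (rule params(1))
    have "n = 2 * final + 2 \<or> n = 2 * final + 3"
      using params(2) by presburger
    then show ?thesis
    proof
      assume 1: "n = 2 * final + 2"
      then have "n - 3 = 2 * final - 1"
        by linarith
      then show ?thesis
        using less_WL1_max_even 1 by metis
    next
      assume 2: "n = 2 * final + 3"
      then have "n - 3 = 2 * final"
        by linarith
      then show ?thesis
        using less_WL1_max_odd 2 by metis
    qed
  qed
  moreover have "WL1_max n < n"
    using assms by (intro WL1_max_less) simp
  ultimately show ?thesis
    using assms by auto
qed

end
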